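(* Let $d\ge 1$ be an integer. A poset $P\in J(\mathbb{N}^d)$ is an Eeta win if and only if for every maximal element $m\in P$, there is a maximal chain in $\mathcal{T}_P(m)$ of even length.
   Context: $\mathbb{N}^d$ carries the product (componentwise) order, and $J(\mathbb{N}^d)$ denotes the set of finite order ideals (finite down-closed subsets) of $\mathbb{N}^d$; each is regarded as a poset with the induced order. Ungar game: for a finite poset $P$, the positions are order ideals $X$ of $P$, the starting position being $X=P$. A nontrivial Ungar move replaces $X$ by $X\setminus T$, where $T$ is a nonempty subset of the set $\max(X)$ of maximal elements of $X$. Two players, Atniss (who moves first) and Eeta (who moves second), alternate making nontrivial Ungar moves; the first player who cannot make one (i.e. the player to move when $X=\varnothing$) loses. A finite poset $P$ is an Atniss win if the first player has a winning strategy starting from $P$, and an Eeta win otherwise. For a maximal element $m$ of $P$, the maximal subposet $\mathcal{M}_P(m)$ is the subposet of all elements that are less than or equal to $m$ but not less than or equal to any other maximal element of $P$. The skeleton $\mathcal{T}_P$ is the subposet of all $x\in P$ for which there are no incomparable $a,b\in P$ with $x<a$ and $x<b$. Put $\mathcal{T}_P(m)=\mathcal{T}_P\cap\mathcal{M}_P(m)$. A chain is a totally ordered subposet; its length is its number of elements. A maximal chain is one that is maximal under inclusion. *)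

theory Defs
  imports Main
begin

text \<open>
  Posets are represented as sets of elements of an ordered type, carrying the induced order.
  \<open>\<nat>\<^sup>d\<close> is the type \<open>'d::finite \<Rightarrow> nat\<close> with \<open>d = CARD('d) \<ge> 1\<close>; the library order on functions is
  the componentwise order.
\<close>

definition finite_order_ideals :: "'a::order set set" where
  "finite_order_ideals = {P. finite P \<and> (\<forall>x\<in>P. \<forall>y. y \<le> x \<longrightarrow> y \<in> P)}"

definition maximal_elements :: "'a::order set \<Rightarrow> 'a set" where
  "maximal_elements X = {x \<in> X. \<not> (\<exists>y\<in>X. x < y)}"

definition maximal_subposet :: "'a::order set \<Rightarrow> 'a \<Rightarrow> 'a set" where
  "maximal_subposet P m =
     {x \<in> P. x \<le> m \<and> \<not> (\<exists>m'\<in>maximal_elements P. m' \<noteq> m \<and> x \<le> m')}"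

definition skeleton :: "'a::order set \<Rightarrow> 'a set" where
  "skeleton P =
     {x \<in> P. \<not> (\<exists>a\<in>P. \<exists>b\<in>P. \<not> a \<le> b \<and> \<not> b \<le> a \<and> x < a \<and> x < b)}"

definition skeleton_at :: "'a::order set \<Rightarrow> 'a \<Rightarrow> 'a set" where
  "skeleton_at P m = skeleton P \<inter> maximal_subposet P m"

definition ungar_move :: "'a::order set \<Rightarrow> 'a set \<Rightarrow> bool" where
  "ungar_move X Y \<longleftrightarrow> (\<exists>T. T \<noteq> {} \<and> T \<subseteq> maximal_elements X \<and> Y = X - T)"

text \<open>
  A play, possibly unfinished, is the list of positions reached so far, the starting position
  included. So Atniss is to move at the last position iff the list has odd length.
\<close>

definition ungar_play :: "'a::order set \<Rightarrow> 'a set list \<Rightarrow> bool" where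
  "ungar_play P Xs \<longleftrightarrow>
     Xs \<noteq> [] \<and> hd Xs = P \<and> (\<forall>i. Suc i < length Xs \<longrightarrow> ungar_move (Xs ! i) (Xs ! Suc i))"

definition complete_play :: "'a::order set \<Rightarrow> 'a set list \<Rightarrow> bool" where
  "complete_play P Xs \<longleftrightarrow> ungar_play P Xs \<and> \<not> (\<exists>Y. ungar_move (last Xs) Y)"

text \<open>
  A strategy for Atniss maps the history of the play to the next position. It has to prescribe a
  legal move whenever Atniss is to move and can move.
\<close>

definition atniss_strategy :: "'a::order set \<Rightarrow> ('a set list \<Rightarrow> 'a set) \<Rightarrow> bool" where
  "atniss_strategy P \<sigma> \<longleftrightarrow>
     (\<forall>Xs. ungar_play P Xs \<and> odd (length Xs) \<and> (\<exists>Y. ungar_move (last Xs) Y)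
        \<longrightarrow> ungar_move (last Xs) (\<sigma> Xs))"

definition follows_strategy :: "('a set list \<Rightarrow> 'a set) \<Rightarrow> 'a set list \<Rightarrow> bool" where
  "follows_strategy \<sigma> Xs \<longleftrightarrow>
     (\<forall>i. even i \<and> Suc i < length Xs \<longrightarrow> Xs ! Suc i = \<sigma> (take (Suc i) Xs))"

text \<open>
  Atniss wins a complete play iff Eeta is the one unable to move at its end, i.e. iff the list of
  positions has even length. For finite \<open>P\<close> every play can be continued to a complete one after
  finitely many moves, so infinite plays need not be considered.
\<close>

definition atniss_win :: "'a::order set \<Rightarrow> bool" where
  "atniss_win P \<longleftrightarrow>
     (\<exists>\<sigma>. atniss_strategy P \<sigma> \<and>
       (\<forall>Xs. complete_play P Xs \<and> follows_strategy \<sigma> Xs \<longrightarrow> even (length Xs)))"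

definition eeta_win :: "'a::order set \<Rightarrow> bool" where
  "eeta_win P \<longleftrightarrow> \<not> atniss_win P"

end

theory Submission
  imports Defs
begin

text \<open>
  Call a position of the game balanced if it satisfies the right-hand side of the theorem. The
  proof shows that the balanced positions are the kernel of the game: no move leads from a balanced
  position to a balanced one (\<open>balanced_move\<close>), and from every other position some move does
  (\<open>move_to_balanced\<close>). Such a kernel always consists of the Eeta wins (\<open>eeta_win_iff_kernel\<close>): the
  player who moves outside the kernel can return to it at every turn, and the empty position, in which
  one loses, lies in it.

  What makes \<open>\<nat>\<^sup>d\<close> special is that an interval which is a chain is a segment in one coordinate
  direction. Hence the tree \<open>\<T>\<^sub>P(m)\<close> is a spider: it consists of \<open>m\<close> and of one arm
  \<open>m - e\<^sub>i, m - 2e\<^sub>i, \<dots>\<close> for each direction \<open>i\<close> (\<open>skeleton_at_eq_arms\<close>). Its maximal chains are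
  the nonempty arms together with \<open>m\<close>, or \<open>{m}\<close> alone, so the condition says that some arm of
  each maximal element has odd length (\<open>even_maxchain_iff\<close>).

  A move removes maximal elements, one after the other say. Removing one of them, \<open>m\<close>, turns
  \<open>m - e\<^sub>i\<close>, if it lies on an arm, into a maximal element whose only arm is the rest of the old one,
  one element shorter. The only side effect is that arms can grow. If the arm of \<open>x\<close> in direction
  \<open>i\<close> has length \<open>k\<close>, then what prevents the point \<open>x - (k+1)e\<^sub>i\<close>, if it exists, from belonging to
  it is a point \<open>x - (k+1)e\<^sub>i + e\<^sub>j\<close> of the position. The coordinate sum of that point is \<open>k\<close> less
  than the one of \<open>x\<close>. So a nonempty arm of \<open>x\<close> can only grow when an element of smaller
  coordinate sum is removed. Two consequences:

  In a balanced position, let \<open>m\<close> have minimal coordinate sum among the removed elements. Its odd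
  arm becomes an even arm of a new maximal element and does not grow, so balance is lost.

  In an unbalanced position, run through the maximal elements in order of increasing coordinate sum
  and remove each one that, in the position reached so far, has only even arms. Every new maximal
  element inherits a nonempty even arm shortened by one, and later removals change no odd arm. The
  result is balanced.
\<close>

section \<open>Kernels and winning strategies\<close>

lemma ungar_play_snoc:
  assumes "ungar_play P Xs" "ungar_move (last Xs) Y"
  shows "ungar_play P (Xs @ [Y])"
proof -
  have "length Xs - Suc 0 = i" if "Suc i = length Xs" for i
    using that by simp
  then show ?thesis
    using assms unfolding ungar_play_def
    by (auto simp: nth_append last_conv_nth less_Suc_eq)
qed

lemma card_ungar_move_less:
  assumes "finite X" "ungar_move X Y"
  shows "card Y < card X"
  using assms unfolding ungar_move_def maximal_elements_def
  by (metis (no_types, lifting) Diff_subset Diff_eq_empty_iff double_diff inf.absorb_iff2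
      mem_Collect_eq psubsetI psubset_card_mono subset_eq Diff_disjoint)

text \<open>
  Eeta defeats a strategy of Atniss by returning to the kernel in each move. The statement is about
  histories, because a strategy may depend on them. It ends because the positions shrink.
\<close>

lemma eeta_counterplay:
  assumes fin: "\<And>X. I X \<Longrightarrow> finite X"
    and closed: "\<And>X Y. I X \<Longrightarrow> ungar_move X Y \<Longrightarrow> I Y"
    and stable: "\<And>X Y. I X \<Longrightarrow> K X \<Longrightarrow> ungar_move X Y \<Longrightarrow> \<not> K Y"
    and absorbing: "\<And>X. I X \<Longrightarrow> \<not> K X \<Longrightarrow> \<exists>Y. ungar_move X Y \<and> K Y"
    and strategy: "atniss_strategy P \<sigma>"
    and "ungar_play P Xs" "follows_strategy \<sigma> Xs" "odd (length Xs)" "I (last Xs)" "K (last Xs)"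
  shows "\<exists>Ys. complete_play P Ys \<and> follows_strategy \<sigma> Ys \<and> odd (length Ys)"
  using assms(6-)
proof (induction "card (last Xs)" arbitrary: Xs rule: less_induct)
  case less
  show ?case
  proof (cases "\<exists>Y. ungar_move (last Xs) Y")
    case False
    then show ?thesis
      using less.prems unfolding complete_play_def by blast
  next
    case True
    define Y where "Y = \<sigma> Xs"
    have Y: "ungar_move (last Xs) Y"
      using True strategy less.prems unfolding atniss_strategy_def Y_def by blast
    then have IY: "I Y" and "\<not> K Y"
      using closed stable less.prems by blast+
    then obtain Z where Z: "ungar_move Y Z" "K Z"
      using absorbing by blast
    have play: "ungar_play P (Xs @ [Y, Z])"
      using ungar_play_snoc[of P "Xs @ [Y]" Z] ungar_play_snoc[of P Xs Y] less.prems(1) Y Z(1)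
      by simp
    have follows: "follows_strategy \<sigma> (Xs @ [Y, Z])"
      unfolding follows_strategy_def
    proof (intro allI impI)
      fix i
      assume i: "even i \<and> Suc i < length (Xs @ [Y, Z])"
      show "(Xs @ [Y, Z]) ! Suc i = \<sigma> (take (Suc i) (Xs @ [Y, Z]))"
      proof (cases "Suc i < length Xs")
        case True
        then show ?thesis
          using i less.prems(2) by (simp add: follows_strategy_def nth_append)
      next
        case False
        \<comment> \<open>The remaining index \<open>length Xs\<close> is odd: that move was Eeta's.\<close>
        have "i \<noteq> length Xs"
          using i less.prems(3) by auto
        with False i have "Suc i = length Xs"
          by auto
        then show ?thesis
          by (simp add: nth_append Y_def)
      qed
    qed
    have "card Z < card (last Xs)"
      using card_ungar_move_less[OF fin] Y Z(1) IY less.prems(4) by (meson order.strict_trans)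
    then show ?thesis
      using less.hyps[of "Xs @ [Y, Z]"] play follows less.prems(3) closed[OF IY Z(1)] Z(2) by simp
  qed
qed

lemma ungar_play_invariant:
  assumes "ungar_play P Xs" "I P" "\<And>X Y. I X \<Longrightarrow> ungar_move X Y \<Longrightarrow> I Y" "n < length Xs"
  shows "I (Xs ! n)"
  using assms(4)
proof (induction n)
  case 0
  then show ?case
    using assms(1,2) by (simp add: ungar_play_def hd_conv_nth)
next
  case (Suc n)
  then show ?case
    using assms(1,3) unfolding ungar_play_def by (meson Suc_lessD)
qed

text \<open>
  The invariant \<open>I\<close> restricts the game to the positions for which the kernel is understood.
\<close>

lemma eeta_win_iff_kernel:
  assumes fin: "\<And>X. I X \<Longrightarrow> finite X"
    and closed: "\<And>X Y. I X \<Longrightarrow> ungar_move X Y \<Longrightarrow> I Y"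
    and stable: "\<And>X Y. I X \<Longrightarrow> K X \<Longrightarrow> ungar_move X Y \<Longrightarrow> \<not> K Y"
    and absorbing: "\<And>X. I X \<Longrightarrow> \<not> K X \<Longrightarrow> \<exists>Y. ungar_move X Y \<and> K Y"
    and P: "I P"
  shows "eeta_win P \<longleftrightarrow> K P"
proof
  assume KP: "K P"
  show "eeta_win P"
    unfolding eeta_win_def atniss_win_def
  proof
    assume "\<exists>\<sigma>. atniss_strategy P \<sigma> \<and>
      (\<forall>Xs. complete_play P Xs \<and> follows_strategy \<sigma> Xs \<longrightarrow> even (length Xs))"
    then obtain \<sigma> where \<sigma>: "atniss_strategy P \<sigma>"
      and win: "\<And>Xs. complete_play P Xs \<Longrightarrow> follows_strategy \<sigma> Xs \<Longrightarrow> even (length Xs)"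
      by blast
    have "\<exists>Ys. complete_play P Ys \<and> follows_strategy \<sigma> Ys \<and> odd (length Ys)"
      by (rule eeta_counterplay[of I K P \<sigma> "[P]", OF fin closed stable absorbing \<sigma>])
        (auto simp: ungar_play_def follows_strategy_def P KP)
    then show False
      using win by blast
  qed
next
  assume eeta: "eeta_win P"
  show "K P"
  proof (rule ccontr)
    assume nKP: "\<not> K P"
    define \<sigma> where "\<sigma> = (\<lambda>Xs. if \<exists>Y. ungar_move (last Xs) Y \<and> K Y
       then SOME Y. ungar_move (last Xs) Y \<and> K Y else SOME Y. ungar_move (last Xs) Y)"
    have \<sigma>_kernel: "K (\<sigma> Xs)" if "\<exists>Y. ungar_move (last Xs) Y \<and> K Y" for Xs
      using that someI_ex[OF that] by (simp add: \<sigma>_def)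
    have \<sigma>_move: "ungar_move (last Xs) (\<sigma> Xs)" if "\<exists>Y. ungar_move (last Xs) Y" for Xs
      using that unfolding \<sigma>_def by (smt (verit) someI_ex)
    have "even (length Xs)" if complete: "complete_play P Xs" and follows: "follows_strategy \<sigma> Xs"
      for Xs
    proof -
      have play: "ungar_play P Xs" and stuck: "\<not> (\<exists>Y. ungar_move (last Xs) Y)"
        using complete by (auto simp: complete_play_def)
      have inv: "I (Xs ! n)" if "n < length Xs" for n
        using ungar_play_invariant[of P Xs I n, OF play P closed that] .
      have alternate: "K (Xs ! n) \<longleftrightarrow> odd n" if "n < length Xs" for n
        using that
      proof (induction n)
        case 0
        then show ?case
          using play nKP by (simp add: ungar_play_def hd_conv_nth)
      next
        case (Suc n)
        then have IH: "K (Xs ! n) \<longleftrightarrow> odd n" and n: "n < length Xs"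
          by auto
        show ?case
        proof (cases "odd n")
          case True
          then show ?thesis
            using IH stable[OF inv[OF n]] play Suc.prems by (auto simp: ungar_play_def)
        next
          case False
          have "last (take (Suc n) Xs) = Xs ! n"
            using n by (simp add: take_Suc_conv_app_nth)
          then have "K (\<sigma> (take (Suc n) Xs))"
            using \<sigma>_kernel absorbing[OF inv[OF n]] IH False by simp
          then show ?thesis
            using follows False Suc.prems by (simp add: follows_strategy_def)
        qed
      qed
      have last: "last Xs = Xs ! (length Xs - 1)" and pos: "length Xs - 1 < length Xs"
        using play by (auto simp: ungar_play_def last_conv_nth)
      \<comment> \<open>A stuck position lies in the kernel, hence was reached by Atniss.\<close>
      have "K (last Xs)"
        using absorbing inv[OF pos] stuck last by metis
      then show ?thesis
        using alternate[OF pos] last pos by simp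
    qed
    then show False
      using eeta \<sigma>_move unfolding eeta_win_def atniss_win_def atniss_strategy_def by blast
  qed
qed

section \<open>Order ideals and their maximal elements\<close>

lemma ideal_downward:
  assumes "P \<in> finite_order_ideals" "x \<in> P" "y \<le> x"
  shows "y \<in> P"
  using assms by (auto simp: finite_order_ideals_def)

lemma ideal_Diff_maximal:
  assumes "P \<in> finite_order_ideals" "S \<subseteq> maximal_elements P"
  shows "P - S \<in> finite_order_ideals"
  using assms unfolding finite_order_ideals_def maximal_elements_def
  by (smt (verit) Diff_iff finite_Diff mem_Collect_eq order_le_less subset_iff)

lemma maximal_Diff:
  assumes "x \<in> maximal_elements P" "x \<notin> S"
  shows "x \<in> maximal_elements (P - S)"
  using assms by (auto simp: maximal_elements_def)

section \<open>Arms\<close>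

text \<open>
  For \<open>k > 0\<close>, the condition says that \<open>m - k e\<^sub>i\<close> is a point of the skeleton below \<open>m\<close>: a point
  \<open>m - k e\<^sub>i + e\<^sub>j\<close> of \<open>P\<close> would be incomparable to \<open>m - (k-1) e\<^sub>i\<close>. For \<open>k = 0\<close> it follows from
  the maximality of \<open>m\<close>. So the length of an arm does not count \<open>m\<close>.
\<close>

definition arm :: "('d::finite \<Rightarrow> nat) set \<Rightarrow> ('d \<Rightarrow> nat) \<Rightarrow> 'd \<Rightarrow> nat \<Rightarrow> bool" where
  "arm P m i k \<longleftrightarrow> k \<le> m i \<and> (\<forall>j. j \<noteq> i \<longrightarrow> m(i := m i - k, j := Suc (m j)) \<notin> P)"

definition arm_length :: "('d::finite \<Rightarrow> nat) set \<Rightarrow> ('d \<Rightarrow> nat) \<Rightarrow> 'd \<Rightarrow> nat" where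
  "arm_length P m i = Max {k. arm P m i k}"

lemma maximal_upd_Suc:
  fixes m :: "'d::finite \<Rightarrow> nat"
  assumes "m \<in> maximal_elements P"
  shows "m(j := Suc (m j)) \<notin> P"
proof -
  have "m < m(j := Suc (m j))"
    by (auto simp: less_fun_def le_fun_def intro!: exI[of _ j])
  then show ?thesis
    using assms by (auto simp: maximal_elements_def)
qed

lemma arm_0: "m \<in> maximal_elements P \<Longrightarrow> arm P m i 0"
  by (auto simp: arm_def maximal_upd_Suc)

lemma arm_antimono:
  assumes P: "P \<in> finite_order_ideals" and k: "arm P m i k" and "l \<le> k"
  shows "arm P m i l"
proof -
  have "m(i := m i - l, j := Suc (m j)) \<notin> P" if "j \<noteq> i" for j
  proof
    assume "m(i := m i - l, j := Suc (m j)) \<in> P"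
    moreover have "m(i := m i - k, j := Suc (m j)) \<le> m(i := m i - l, j := Suc (m j))"
      using \<open>l \<le> k\<close> by (auto simp: le_fun_def)
    ultimately show False
      using ideal_downward[OF P] k that unfolding arm_def by blast
  qed
  then show ?thesis
    using k \<open>l \<le> k\<close> by (auto simp: arm_def)
qed

lemma arm_iff_le_arm_length:
  assumes P: "P \<in> finite_order_ideals" and m: "m \<in> maximal_elements P"
  shows "arm P m i k \<longleftrightarrow> k \<le> arm_length P m i"
proof -
  have fin: "finite {k. arm P m i k}"
    by (rule finite_subset[of _ "{..m i}"]) (auto simp: arm_def)
  have "{k. arm P m i k} \<noteq> {}"
    using arm_0[OF m] by blast
  then have "arm P m i (arm_length P m i)"
    using Max_in[OF fin] by (simp add: arm_length_def)
  then show ?thesis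
    using arm_antimono[OF P] Max_ge[OF fin] unfolding arm_length_def by blast
qed

lemma arm_length_eqI:
  assumes "P \<in> finite_order_ideals" "m \<in> maximal_elements P" "arm P m i k" "\<not> arm P m i (Suc k)"
  shows "arm_length P m i = k"
  using assms(3,4) arm_iff_le_arm_length[OF assms(1,2)] by (metis not_less_eq_eq le_antisym)

text \<open>
  A point that is above a point of an arm and off its line is above one of the points that the
  definition of an arm excludes.
\<close>

lemma above_arm:
  assumes P: "P \<in> finite_order_ideals" and k: "arm P m i k"
    and z: "z \<in> P" "m(i := m i - k) \<le> z"
  shows "z = m(i := z i)"
proof
  fix j
  show "z j = (m(i := z i)) j"
  proof (cases "j = i")
    case False
    have "m j \<le> z j"
      using z(2) False by (auto simp: le_fun_def dest: spec[of _ j])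
    moreover have "\<not> m j < z j"
    proof
      assume "m j < z j"
      then have "m(i := m i - k, j := Suc (m j)) \<le> z"
        using z(2) by (auto simp: le_fun_def)
      then show False
        using ideal_downward[OF P z(1)] k False by (auto simp: arm_def)
    qed
    ultimately show ?thesis
      using False by simp
  qed simp
qed

text \<open>
  If \<open>x < m\<close> had two coordinates smaller than those of \<open>m\<close>, or a point above it off the line
  through \<open>m\<close>, then raising two different coordinates of \<open>x\<close> by one would give incomparable points
  of \<open>P\<close>, so that \<open>x\<close> would not be in the skeleton.
\<close>

lemma skeleton_at_eq_arms:
  fixes m :: "'d::finite \<Rightarrow> nat"
  assumes P: "P \<in> finite_order_ideals" and m: "m \<in> maximal_elements P"
  shows "skeleton_at P m = {m(i := m i - k) | i k. arm P m i k}"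
proof (intro equalityI subsetI)
  fix x
  assume "x \<in> skeleton_at P m"
  then have xP: "x \<in> P" and xm: "x \<le> m"
    and comparable: "\<And>a b. a \<in> P \<Longrightarrow> b \<in> P \<Longrightarrow> x < a \<Longrightarrow> x < b \<Longrightarrow> a \<le> b \<or> b \<le> a"
    by (auto simp: skeleton_at_def skeleton_def maximal_subposet_def)
  have mP: "m \<in> P"
    using m by (simp add: maximal_elements_def)
  have no_two: False
    if "i \<noteq> j" "x(i := Suc (x i)) \<in> P" "x(j := Suc (x j)) \<in> P" for i j
  proof -
    have "x < x(l := Suc (x l))" for l
      by (auto simp: less_fun_def le_fun_def intro!: exI[of _ l])
    then have "x(i := Suc (x i)) \<le> x(j := Suc (x j)) \<or> x(j := Suc (x j)) \<le> x(i := Suc (x i))"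
      using comparable that by blast
    then show False
      using that(1) by (auto simp: le_fun_def dest: spec[of _ i] spec[of _ j])
  qed
  have raise: "x(i := Suc (x i)) \<in> P" if "x i < m i" for i
  proof (rule ideal_downward[OF P mP])
    show "x(i := Suc (x i)) \<le> m"
      using xm that by (auto simp: le_fun_def)
  qed
  show "x \<in> {m(i := m i - k) | i k. arm P m i k}"
  proof (cases "x = m")
    case True
    have "m(undefined := m undefined - 0) = m"
      by simp
    then show ?thesis
      using True arm_0[OF m] by (smt (verit) mem_Collect_eq)
  next
    case False
    with xm obtain i where i: "x i < m i"
      by (metis ext le_funD order_le_less)
    have off: "x j = m j" if "j \<noteq> i" for j
      using no_two[OF that] raise i xm that by (metis le_funD order_le_less)
    then have x_eq: "x = m(i := m i - (m i - x i))"
      using i by (auto simp: fun_eq_iff)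
    have "m(i := m i - (m i - x i), j := Suc (m j)) \<notin> P" if "j \<noteq> i" for j
      using no_two[of i j] raise[OF i] that x_eq off by metis
    then have "arm P m i (m i - x i)"
      by (simp add: arm_def)
    then show ?thesis
      using x_eq by blast
  qed
next
  fix x
  assume "x \<in> {m(i := m i - k) | i k. arm P m i k}"
  then obtain i k where x: "x = m(i := m i - k)" and k: "arm P m i k"
    by blast
  have above: "z = m(i := z i)" if "z \<in> P" "x \<le> z" for z
    using above_arm[OF P k that(1)] that(2) x by simp
  have comparable: "a \<le> b \<or> b \<le> a" if "a \<in> P" "b \<in> P" "x \<le> a" "x \<le> b" for a b
  proof -
    have "m(i := a i) \<le> m(i := b i) \<or> m(i := b i) \<le> m(i := a i)"
      by (auto simp: le_fun_def)
    then show ?thesis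
      using above that by metis
  qed
  have xm: "x \<le> m"
    using x by (auto simp: le_fun_def)
  have mP: "m \<in> P"
    using m by (simp add: maximal_elements_def)
  have xP: "x \<in> P"
    using ideal_downward[OF P mP xm] .
  have "m' = m" if "m' \<in> maximal_elements P" "x \<le> m'" for m'
    using comparable[of m m'] that m xm unfolding maximal_elements_def
    by (metis (mono_tags, lifting) mem_Collect_eq order_le_less)
  then show "x \<in> skeleton_at P m"
    using xP xm comparable unfolding skeleton_at_def skeleton_def maximal_subposet_def
    by (blast dest: less_imp_le)
qed

lemma inj_arm_points: "inj_on (\<lambda>k. m(i := m i - k)) {..m i :: nat}"
  by (rule inj_onI) (metis atMost_iff diff_diff_cancel fun_upd_same)

text \<open>
  Points on different arms, other than \<open>m\<close>, are incomparable. So a maximal chain with more than one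
  element is a whole arm together with \<open>m\<close>.
\<close>

lemma even_maxchain_iff:
  fixes m :: "'d::finite \<Rightarrow> nat"
  assumes P: "P \<in> finite_order_ideals" and m: "m \<in> maximal_elements P"
  shows "(\<exists>C. pred_on.maxchain (skeleton_at P m) (\<le>) C \<and> even (card C)) \<longleftrightarrow>
    (\<exists>i. odd (arm_length P m i))"
proof -
  let ?T = "skeleton_at P m"
  define A where "A = (\<lambda>i. (\<lambda>k. m(i := m i - k)) ` {..arm_length P m i})"
  note arm_iff = arm_iff_le_arm_length[OF P m]
  have T: "x \<in> ?T \<longleftrightarrow> (\<exists>i. x \<in> A i)" for x
    by (auto simp: skeleton_at_eq_arms[OF P m] A_def arm_iff)
  have le: "arm_length P m i \<le> m i" for i
    using arm_iff[of i "arm_length P m i"] by (simp add: arm_def)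
  have card_A: "card (A i) = Suc (arm_length P m i)" for i
    unfolding A_def using le[of i]
    by (subst card_image) (auto intro: inj_on_subset[OF inj_arm_points])
  have m_A: "m \<in> A i" for i
    unfolding A_def by (rule image_eqI[of _ _ 0]) auto
  have A_le: "x \<le> m" if "x \<in> A i" for x i
    using that by (auto simp: A_def le_fun_def)
  have A_chain: "x \<le> y \<or> y \<le> x" if xy: "x \<in> A i" "y \<in> A i" for x y i
  proof -
    obtain k l where "x = m(i := m i - k)" "y = m(i := m i - l)"
      using xy unfolding A_def by blast
    then show ?thesis
      by (cases "k \<le> l") (auto simp: le_fun_def)
  qed
  have same_arm: "y \<in> A i"
    if xy: "x \<in> A i" "x \<noteq> m" "y \<in> ?T" "x \<le> y \<or> y \<le> x" for x y i
  proof -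
    obtain j where j: "y \<in> A j"
      using xy(3) T by blast
    obtain k l where x: "x = m(i := m i - k)" and y: "y = m(j := m j - l)"
      using xy(1) j by (auto simp: A_def)
    have "y = m" if "j \<noteq> i"
    proof -
      have "x i < m i"
        using x xy(2) by (metis fun_upd_same fun_upd_triv diff_le_self order_le_less)
      moreover have "y i = m i" "x j = m j"
        using x y that by auto
      ultimately have "x \<le> y"
        using xy(4) by (metis le_funD leD)
      then have "m j \<le> y j"
        using \<open>x j = m j\<close> by (metis le_funD)
      then show ?thesis
        using y by (metis diff_le_self fun_upd_same fun_upd_triv order_antisym)
    qed
    then show ?thesis
      using j m_A by metis
  qed
  have chain_A: "pred_on.chain ?T (\<le>) (A i)" for i
    unfolding pred_on.chain_def using A_chain T by auto
  have comp: "x \<le> y \<or> y \<le> x" if "pred_on.chain ?T (\<le>) C" "x \<in> C" "y \<in> C" for C x y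
    using that unfolding pred_on.chain_def by auto
  show ?thesis
  proof
    assume "\<exists>i. odd (arm_length P m i)"
    then obtain i where i: "odd (arm_length P m i)"
      by blast
    define x where "x = m(i := m i - arm_length P m i)"
    have x: "x \<in> A i" "x \<noteq> m"
      using odd_pos[OF i] le[of i] by (auto simp: x_def A_def fun_eq_iff)
    have "\<not> A i \<subset> C" if C: "pred_on.chain ?T (\<le>) C" for C
    proof
      assume sub: "A i \<subset> C"
      then obtain y where y: "y \<in> C" "y \<notin> A i"
        by blast
      have "y \<in> ?T"
        using C y(1) unfolding pred_on.chain_def by blast
      moreover have "x \<le> y \<or> y \<le> x"
        using comp[OF C] sub x(1) y(1) by blast
      ultimately show False
        using same_arm[OF x] y(2) by blast
    qed
    then have "pred_on.maxchain ?T (\<le>) (A i)"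
      using chain_A unfolding pred_on.maxchain_def by blast
    then show "\<exists>C. pred_on.maxchain ?T (\<le>) C \<and> even (card C)"
      using i card_A by (metis even_Suc)
  next
    assume "\<exists>C. pred_on.maxchain ?T (\<le>) C \<and> even (card C)"
    then obtain C where C: "pred_on.chain ?T (\<le>) C"
      and max: "\<And>D. pred_on.chain ?T (\<le>) D \<Longrightarrow> C \<subseteq> D \<Longrightarrow> C = D" and "even (card C)"
      unfolding pred_on.maxchain_def by blast
    have CT: "C \<subseteq> ?T"
      using C unfolding pred_on.chain_def by blast
    have "x \<le> m" if "x \<in> C" for x
      using CT T A_le that by blast
    moreover have "m \<in> ?T"
      using T m_A by blast
    ultimately have "pred_on.chain ?T (\<le>) (insert m C)"
      using CT comp[OF C] unfolding pred_on.chain_def by auto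
    then have mC: "m \<in> C"
      using max by blast
    \<comment> \<open>The chain \<open>{m}\<close> has odd length.\<close>
    moreover have "C \<noteq> {m}"
      using \<open>even (card C)\<close> by auto
    ultimately obtain x where x: "x \<in> C" "x \<noteq> m"
      by blast
    then obtain i where i: "x \<in> A i"
      using CT T by blast
    have "C \<subseteq> A i"
      using same_arm[OF i x(2)] CT comp[OF C x(1)] by blast
    then have "C = A i"
      using max[OF chain_A] by blast
    then show "\<exists>i. odd (arm_length P m i)"
      using \<open>even (card C)\<close> card_A by (metis even_Suc)
  qed
qed

section \<open>Arms after a move\<close>

definition weight :: "('d::finite \<Rightarrow> nat) \<Rightarrow> nat" where
  "weight x = (\<Sum>i\<in>UNIV. x i)"

lemma weight_strict_mono:
  fixes x y :: "'d::finite \<Rightarrow> nat"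
  assumes "x < y"
  shows "weight x < weight y"
proof -
  have le: "\<And>i. x i \<le> y i"
    using assms by (simp add: less_fun_def le_fun_def)
  moreover obtain i where "x i < y i"
    using assms by (metis le_fun_def less_fun_def not_le)
  ultimately show ?thesis
    unfolding weight_def by (intro sum_strict_mono_ex1) auto
qed

lemma weight_upd: "weight (x(i := n)) + x i = weight x + n"
proof -
  have split: "weight y = y i + sum y (UNIV - {i})" for y :: "'a \<Rightarrow> nat"
    unfolding weight_def by (simp add: sum.remove)
  have "sum (x(i := n)) (UNIV - {i}) = sum x (UNIV - {i})"
    by (intro sum.cong) auto
  then show ?thesis
    using split[of x] split[of "x(i := n)"] by simp
qed

text \<open>
  The weight of the blocking point is \<open>weight m - arm_length P m i\<close>. This is where an empty arm
  differs: its blocker only has the same weight as \<open>m\<close>.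
\<close>

lemma arm_blocker:
  fixes m :: "'d::finite \<Rightarrow> nat"
  assumes P: "P \<in> finite_order_ideals" and m: "m \<in> maximal_elements P"
    and pos: "0 < arm_length P m i" and room: "Suc (arm_length P m i) \<le> m i"
  obtains j where "j \<noteq> i" "m(i := m i - Suc (arm_length P m i), j := Suc (m j)) \<in> P"
    "weight (m(i := m i - Suc (arm_length P m i), j := Suc (m j))) < weight m"
proof -
  let ?k = "arm_length P m i"
  have "\<not> arm P m i (Suc ?k)"
    by (simp add: arm_iff_le_arm_length[OF P m])
  then obtain j where j: "j \<noteq> i" "m(i := m i - Suc ?k, j := Suc (m j)) \<in> P"
    using room by (auto simp: arm_def)
  have "weight (m(i := m i - Suc ?k, j := Suc (m j))) < weight m"
    using weight_upd[of m i "m i - Suc ?k"] weight_upd[of "m(i := m i - Suc ?k)" j "Suc (m j)"]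
      pos room j(1) by simp
  with j show ?thesis
    using that by blast
qed

lemma arm_length_Diff:
  fixes x :: "'d::finite \<Rightarrow> nat"
  assumes P: "P \<in> finite_order_ideals" and S: "S \<subseteq> maximal_elements P"
    and heavy: "\<And>n. n \<in> S \<Longrightarrow> weight x \<le> weight n"
    and x: "x \<in> maximal_elements P" "x \<notin> S" and pos: "0 < arm_length P x i"
  shows "arm_length (P - S) x i = arm_length P x i"
proof (rule arm_length_eqI[OF ideal_Diff_maximal[OF P S] maximal_Diff[OF x]])
  have "arm P x i (arm_length P x i)"
    by (simp add: arm_iff_le_arm_length[OF P x(1)])
  then show "arm (P - S) x i (arm_length P x i)"
    by (auto simp: arm_def)
  show "\<not> arm (P - S) x i (Suc (arm_length P x i))"
  proof
    assume a: "arm (P - S) x i (Suc (arm_length P x i))"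
    then have "Suc (arm_length P x i) \<le> x i"
      by (simp add: arm_def)
    from arm_blocker[OF P x(1) pos this] show False
      using a heavy unfolding arm_def by (metis DiffI leD)
  qed
qed

text \<open>
  When \<open>m\<close> is removed, the arm in direction \<open>i\<close> survives, shortened by one, as an arm of its first
  point \<open>m - e\<^sub>i\<close>. The point \<open>m - e\<^sub>i\<close> has no other arm, because \<open>m - e\<^sub>i - e\<^sub>j\<close> is also below
  \<open>m - e\<^sub>j\<close>, which stays in the position.
\<close>

lemma arm_lengths_after_removal:
  fixes m :: "'d::finite \<Rightarrow> nat"
  assumes P: "P \<in> finite_order_ideals" and S: "S \<subseteq> maximal_elements P"
    and heavy: "\<And>n. n \<in> S \<Longrightarrow> weight m \<le> weight n"
    and m: "m \<in> S" and pos: "0 < arm_length P m i"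
  defines "m' \<equiv> m(i := m i - 1)"
  shows "m' \<in> maximal_elements (P - S)"
    and "arm_length (P - S) m' i = arm_length P m i - 1"
    and "j \<noteq> i \<Longrightarrow> arm_length (P - S) m' j = 0"
proof -
  let ?k = "arm_length P m i"
  have mmax: "m \<in> maximal_elements P"
    using m S by blast
  then have mP: "m \<in> P" and m_top: "\<And>z. z \<in> P \<Longrightarrow> \<not> m < z"
    by (auto simp: maximal_elements_def)
  note Q = ideal_Diff_maximal[OF P S]
  have arm1: "arm P m i 1" and armk: "arm P m i ?k"
    using pos by (simp_all add: arm_iff_le_arm_length[OF P mmax])
  have mi: "1 \<le> m i"
    using arm1 by (simp add: arm_def)
  have lower: "m(j := m j - 1) \<in> P - S" if "1 \<le> m j" for j
  proof -
    have le: "m(j := m j - 1) \<le> m"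
      by (simp add: le_fun_def)
    moreover have "m(j := m j - 1) \<noteq> m"
      using that by (metis diff_less fun_upd_same less_irrefl less_le_trans zero_less_one)
    ultimately have "m(j := m j - 1) < m"
      by simp
    then have "m(j := m j - 1) \<notin> S"
      using S mP by (auto simp: maximal_elements_def)
    then show ?thesis
      using ideal_downward[OF P mP le] by blast
  qed
  have "\<not> m' < z" if z: "z \<in> P - S" for z
  proof
    assume less: "m' < z"
    then have z_eq: "z = m(i := z i)"
      using above_arm[OF P arm1] z by (simp add: m'_def less_imp_le)
    have "m' i < z i"
    proof (rule ccontr)
      assume "\<not> m' i < z i"
      then have "z \<le> m'"
        using z_eq by (metis fun_upd_def le_fun_def m'_def not_le order_refl)
      then show False
        using less by simp
    qed
    then have "m i \<le> z i"
      using mi by (simp add: m'_def)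
    then have "m \<le> z"
      using z_eq by (metis fun_upd_def le_fun_def order_refl)
    then have "z = m"
      using m_top z by (metis DiffD1 order_le_less)
    then show False
      using z m by blast
  qed
  then show m'_max: "m' \<in> maximal_elements (P - S)"
    using lower[OF mi] by (auto simp: maximal_elements_def m'_def)
  have shift: "m'(i := m' i - l, j := Suc (m' j)) = m(i := m i - Suc l, j := Suc (m j))"
    if "j \<noteq> i" for l j
    using that by (simp add: m'_def)
  have shift_le: "l \<le> m' i \<longleftrightarrow> Suc l \<le> m i" for l
    using mi by (auto simp: m'_def)
  show "arm_length (P - S) m' i = ?k - 1"
  proof (rule arm_length_eqI[OF Q m'_max])
    show "arm (P - S) m' i (?k - 1)"
      using armk pos shift[of _ "?k - 1"] shift_le[of "?k - 1"] by (simp add: arm_def)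
    show "\<not> arm (P - S) m' i (Suc (?k - 1))"
    proof
      assume "arm (P - S) m' i (Suc (?k - 1))"
      then have a: "Suc ?k \<le> m i" "\<And>j. j \<noteq> i \<Longrightarrow> m(i := m i - Suc ?k, j := Suc (m j)) \<notin> P - S"
        using pos unfolding arm_def by (auto simp: shift shift_le)
      from arm_blocker[OF P mmax pos a(1)] show False
        using a(2) heavy by (metis DiffI leD)
    qed
  qed
  show "arm_length (P - S) m' j = 0" if "j \<noteq> i"
  proof (rule arm_length_eqI[OF Q m'_max arm_0[OF m'_max]])
    show "\<not> arm (P - S) m' j (Suc 0)"
    proof
      assume a: "arm (P - S) m' j (Suc 0)"
      then have mj: "1 \<le> m j"
        using that by (simp add: arm_def m'_def)
      have "m'(j := m' j - Suc 0, i := Suc (m' i)) = m(j := m j - 1)"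
        using that mi by (auto simp: m'_def fun_eq_iff)
      then show False
        using a lower[OF mj] that unfolding arm_def by metis
    qed
  qed
qed

text \<open>
  Any point above \<open>x\<close> other than \<open>m\<close> would still prevent \<open>x\<close> from being maximal. So \<open>m\<close> is the
  only point above \<open>x\<close>.
\<close>

lemma new_maximal_on_arm:
  fixes m :: "'d::finite \<Rightarrow> nat"
  assumes P: "P \<in> finite_order_ideals" and m: "m \<in> maximal_elements P"
    and x: "x \<in> maximal_elements (P - {m})" "x \<notin> maximal_elements P"
  obtains i where "x = m(i := m i - 1)" "0 < arm_length P m i"
proof -
  have xP: "x \<in> P" and x_top: "\<And>z. z \<in> P \<Longrightarrow> x < z \<Longrightarrow> z = m" and mP: "m \<in> P"
    using x(1) m by (auto simp: maximal_elements_def)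
  have "x < m"
    using x(2) xP x_top by (auto simp: maximal_elements_def)
  then have le: "\<And>i. x i \<le> m i"
    by (simp add: less_fun_def le_fun_def)
  obtain i where i: "x i < m i"
    using \<open>x < m\<close> by (metis le_fun_def less_fun_def not_le)
  have raise: "x < x(j := Suc (x j))" for j
    by (auto simp: less_fun_def le_fun_def intro!: exI[of _ j])
  have "x(i := Suc (x i)) \<le> m"
    using le i by (auto simp: le_fun_def)
  then have m_eq: "m = x(i := Suc (x i))"
    using x_top[OF ideal_downward[OF P mP] raise] by blast
  then have x_eq: "x = m(i := m i - 1)"
    by simp
  have "m(i := m i - 1, j := Suc (m j)) \<notin> P" if "j \<noteq> i" for j
  proof
    assume "m(i := m i - 1, j := Suc (m j)) \<in> P"
    moreover have "m(i := m i - 1, j := Suc (m j)) = x(j := Suc (x j))"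
      using that by (simp add: m_eq)
    ultimately have "x(j := Suc (x j)) = m"
      using x_top raise by metis
    then show False
      using that i by (metis fun_upd_other less_irrefl)
  qed
  then have "arm P m i 1"
    using i by (simp add: arm_def)
  then show ?thesis
    using that x_eq arm_iff_le_arm_length[OF P m] by (metis One_nat_def Suc_le_eq)
qed

section \<open>The balanced positions form the kernel\<close>

definition balanced :: "('d::finite \<Rightarrow> nat) set \<Rightarrow> bool" where
  "balanced P \<longleftrightarrow> (\<forall>m \<in> maximal_elements P. \<exists>i. odd (arm_length P m i))"

lemma balanced_move:
  fixes P :: "('d::finite \<Rightarrow> nat) set"
  assumes P: "P \<in> finite_order_ideals" and bal: "balanced P" and move: "ungar_move P Q"
  shows "\<not> balanced Q"
proof -
  obtain S where S: "S \<noteq> {}" "S \<subseteq> maximal_elements P" and Q: "Q = P - S"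
    using move by (auto simp: ungar_move_def)
  obtain m where m: "m \<in> S" and heavy: "\<And>n. n \<in> S \<Longrightarrow> weight m \<le> weight n"
    using ex_has_least_nat[of "\<lambda>n. n \<in> S" _ weight] S(1) by blast
  obtain i where i: "odd (arm_length P m i)"
    using bal m S(2) by (auto simp: balanced_def)
  note after = arm_lengths_after_removal[OF P S(2) heavy m odd_pos[OF i]]
  have "even (arm_length Q (m(i := m i - 1)) j)" for j
    using after(2) after(3)[of j] i by (cases "j = i") (simp_all add: Q)
  then show ?thesis
    using after(1) by (auto simp: balanced_def Q)
qed

text \<open>
  The induction over \<open>U\<close> adds elements in order of increasing weight, so that each removal leaves
  alone the odd arms that have been established before.
\<close>

lemma greedy_removal:
  fixes P :: "('d::finite \<Rightarrow> nat) set"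
  assumes P: "P \<in> finite_order_ideals" and "finite U" "U \<subseteq> maximal_elements P"
  shows "\<exists>S\<subseteq>U. \<forall>x \<in> maximal_elements (P - S). x \<in> U \<or> x \<notin> maximal_elements P
    \<longrightarrow> (\<exists>i. odd (arm_length (P - S) x i))"
  using assms(2,3)
proof (induction U rule: finite_ranking_induct[where f = weight])
  case empty
  show ?case
    by (intro exI[of _ "{}"]) auto
next
  case (insert m U)
  have m: "m \<in> maximal_elements P"
    using insert.prems by blast
  obtain S where S: "S \<subseteq> U" and good: "\<And>x. x \<in> maximal_elements (P - S) \<Longrightarrow>
      x \<in> U \<or> x \<notin> maximal_elements P \<Longrightarrow> \<exists>i. odd (arm_length (P - S) x i)"
    using insert.IH insert.prems by blast
  have S_max: "S \<subseteq> maximal_elements P"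
    using S insert.prems by blast
  show ?case
  proof (cases "m \<in> maximal_elements (P - S) \<longrightarrow> (\<exists>i. odd (arm_length (P - S) m i))")
    case True
    then show ?thesis
      using S good by (intro exI[of _ S]) auto
  next
    case False
    define Y where "Y = P - S"
    have Y: "Y \<in> finite_order_ideals"
      using ideal_Diff_maximal[OF P S_max] by (simp add: Y_def)
    have mY: "m \<in> maximal_elements Y" and even: "\<And>i. even (arm_length Y m i)"
      using False by (auto simp: Y_def)
    have Diff: "P - insert m S = Y - {m}"
      by (auto simp: Y_def)
    have "\<exists>i. odd (arm_length (Y - {m}) x i)"
      if x: "x \<in> maximal_elements (Y - {m})" and xU: "x \<in> insert m U \<or> x \<notin> maximal_elements P"
      for x
    proof (cases "x \<in> maximal_elements Y")
      case True
      have "x \<noteq> m"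
        using x by (auto simp: maximal_elements_def)
      then have xU': "x \<in> U \<or> x \<notin> maximal_elements P"
        using xU by blast
      then obtain i where i: "odd (arm_length Y x i)"
        using good True by (auto simp: Y_def)
      have "weight x \<le> weight m"
      proof (cases "x \<in> U")
        case True
        then show ?thesis
          using insert.hyps by blast
      next
        case False
        \<comment> \<open>A new maximal element lies below a removed one.\<close>
        then obtain n where "n \<in> S" "x < n"
          using xU' True by (auto simp: Y_def maximal_elements_def)
        then show ?thesis
          using weight_strict_mono[of x n] insert.hyps S by fastforce
      qed
      then have "arm_length (Y - {m}) x i = arm_length Y x i"
        using mY \<open>x \<noteq> m\<close> by (intro arm_length_Diff[OF Y _ _ True _ odd_pos[OF i]]) auto
      then show ?thesis
        using i by metis
    next
      case False
      obtain i where x_eq: "x = m(i := m i - 1)" and pos: "0 < arm_length Y m i"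
        using new_maximal_on_arm[OF Y mY x False] .
      have "arm_length (Y - {m}) x i = arm_length Y m i - 1"
        unfolding x_eq using mY pos by (intro arm_lengths_after_removal(2)[OF Y]) auto
      moreover have "odd (arm_length Y m i - 1)"
        using even[of i] pos by (cases "arm_length Y m i") auto
      ultimately show ?thesis
        by metis
    qed
    then show ?thesis
      using S by (intro exI[of _ "insert m S"]) (auto simp: Diff)
  qed
qed

lemma move_to_balanced:
  fixes P :: "('d::finite \<Rightarrow> nat) set"
  assumes P: "P \<in> finite_order_ideals" and "\<not> balanced P"
  shows "\<exists>Q. ungar_move P Q \<and> balanced Q"
proof -
  have "finite (maximal_elements P)"
    using P by (auto simp: finite_order_ideals_def maximal_elements_def)
  from greedy_removal[OF P this subset_refl]
  obtain S where S: "S \<subseteq> maximal_elements P" and bal: "balanced (P - S)"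
    unfolding balanced_def by blast
  then have "S \<noteq> {}"
    using assms(2) by auto
  then show ?thesis
    using S bal unfolding ungar_move_def by blast
qed

theorem corollary1p9:
  fixes P :: "('d::finite \<Rightarrow> nat) set"
  assumes "P \<in> finite_order_ideals"
  shows "eeta_win P \<longleftrightarrow>
    (\<forall>m \<in> maximal_elements P.
       \<exists>C. pred_on.maxchain (skeleton_at P m) (\<le>) C \<and> even (card C))"
proof -
  have "eeta_win P \<longleftrightarrow> balanced P"
  proof (rule eeta_win_iff_kernel[where I = "\<lambda>X. X \<in> finite_order_ideals"])
    fix X Y :: "('d \<Rightarrow> nat) set"
    assume X: "X \<in> finite_order_ideals"
    then show "finite X"
      by (simp add: finite_order_ideals_def)
    show "Y \<in> finite_order_ideals" if "ungar_move X Y"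
      using that ideal_Diff_maximal[OF X] by (auto simp: ungar_move_def)
  qed (simp_all add: assms balanced_move move_to_balanced)
  also have "\<dots> \<longleftrightarrow> (\<forall>m \<in> maximal_elements P.
      \<exists>C. pred_on.maxchain (skeleton_at P m) (\<le>) C \<and> even (card C))"
    unfolding balanced_def by (intro ball_cong refl even_maxchain_iff[OF assms, symmetric])
  finally show ?thesis .
qed

end
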